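(* Let $f\in\mathcal{M}$, let $\chi$ be a Dirichlet character and let $F$ be an infinite set of prime numbers with $\sum_{p\in F}\frac1p<+\infty$ such that $f(n)=\chi(n)$ for all $n\in\mathbb{N}$ coprime with all elements of $F$. Then $f$ is RAP and has a unique Furstenberg system. In particular, the mean $M(f)=\lim_{N\to\infty}\frac1N\sum_{n\le N}f(n)$ exists.
   Context: $\mathcal{M}$ is the class of multiplicative functions $f:\mathbb{N}\to\mathbb{C}$ ($f(mn)=f(m)f(n)$ for coprime $m,n$) with $|f|\le1$. $f$ is (Besicovitch) rationally almost periodic (RAP) if for each $\varepsilon>0$ there is a periodic sequence $f_\varepsilon$ with $\limsup_{N\to\infty}\frac1N\sum_{n<N}|f(n)-f_\varepsilon(n)|<\varepsilon$. Furstenberg systems: let $\mathbb{U}$ be the closed unit disc and $S$ the left shift on $\mathbb{U}^{\mathbb{Z}}$; view $f$ as an element of $\mathbb{U}^{\mathbb{Z}}$ (extended e.g. by $0$ to non-positive integers) and let $X_f=\overline{\{S^nf:n\in\mathbb{Z}\}}$. A Furstenberg system of $f$ is any system $(X_f,\nu,S)$ with $\nu$ a weak$^*$ limit $\lim_{k\to\infty}\frac1{N_k}\sum_{n\le N_k}\delta_{S^nf}$ for some $N_k\to\infty$. It is unique if $\lim_{N\to\infty}\frac1N\sum_{n\le N}\delta_{S^nf}$ exists in the weak$^*$ topology. *)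

theory Defs
  imports "HOL-Probability.Probability"
begin

text \<open>
  Arithmetic functions on the positive integers are represented as functions on type
  \<^typ>\<open>nat\<close>; their value at \<open>0\<close> is irrelevant and never used.
\<close>

definition class_M :: "(nat \<Rightarrow> complex) set" where
  "class_M = {f. (\<forall>m n. m > 0 \<longrightarrow> n > 0 \<longrightarrow> coprime m n \<longrightarrow> f (m * n) = f m * f n) \<and>
                 (\<forall>n. n > 0 \<longrightarrow> norm (f n) \<le> 1)}"

definition dirichlet_character :: "nat \<Rightarrow> (nat \<Rightarrow> complex) \<Rightarrow> bool" where
  "dirichlet_character q chi \<longleftrightarrow>
     q > 0 \<and>
     (\<forall>m n. chi (m * n) = chi m * chi n) \<and>
     (\<forall>n. chi (n + q) = chi n) \<and>
     (\<forall>n. chi n \<noteq> 0 \<longleftrightarrow> coprime n q)"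

definition periodic_seq :: "(nat \<Rightarrow> 'a) \<Rightarrow> bool" where
  "periodic_seq g \<longleftrightarrow> (\<exists>q>0. \<forall>n. g (n + q) = g n)"

definition RAP :: "(nat \<Rightarrow> complex) \<Rightarrow> bool" where
  "RAP f \<longleftrightarrow>
     (\<forall>\<epsilon>::real. \<epsilon> > 0 \<longrightarrow>
       (\<exists>g :: nat \<Rightarrow> complex. periodic_seq g \<and>
          limsup (\<lambda>N. ereal ((1 / real N) * (\<Sum>n\<in>{1..<N}. norm (f n - g n)))) < ereal \<epsilon>))"

definition extend_by_zero :: "(nat \<Rightarrow> complex) \<Rightarrow> int \<Rightarrow> complex" where
  "extend_by_zero f m = (if m > 0 then f (nat m) else 0)"

text \<open>\<open>left_shift n\<close> is the \<open>n\<close>-th iterate (\<open>n\<close> any integer) of the left shift \<open>(S x)(m) = x (m + 1)\<close>.\<close>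

definition left_shift :: "int \<Rightarrow> (int \<Rightarrow> complex) \<Rightarrow> int \<Rightarrow> complex" where
  "left_shift n x = (\<lambda>m. x (m + n))"

text \<open>
  The closure is taken in the product topology on all of \<^typ>\<open>int \<Rightarrow> complex\<close>. For
  \<open>f\<close> bounded by one this is the closure in the set of sequences with values in the closed
  unit disc, since that set is closed.
\<close>

definition orbit_closure :: "(nat \<Rightarrow> complex) \<Rightarrow> (int \<Rightarrow> complex) set" where
  "orbit_closure f = closure (range (\<lambda>n. left_shift n (extend_by_zero f)))"

text \<open>
  The measure \<open>1/N * (\<Sum>n=1..N. \<delta>_{S^n f})\<close> on the orbit closure, as the image of the uniform
  probability measure on \<open>{1..N}\<close>; see \<open>integral_empirical_measure\<close> below.
\<close>

definition empirical_measure :: "(nat \<Rightarrow> complex) \<Rightarrow> nat \<Rightarrow> (int \<Rightarrow> complex) measure" where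
  "empirical_measure f N =
     distr (uniform_count_measure {1..N}) (restrict_space borel (orbit_closure f))
       (\<lambda>n. left_shift (int n) (extend_by_zero f))"

definition borel_prob_on :: "'a::topological_space set \<Rightarrow> 'a measure \<Rightarrow> bool" where
  "borel_prob_on X \<nu> \<longleftrightarrow> prob_space \<nu> \<and> sets \<nu> = sets (restrict_space borel X)"

definition weak_star_limit ::
  "'a::topological_space set \<Rightarrow> (nat \<Rightarrow> 'a measure) \<Rightarrow> 'a measure \<Rightarrow> bool" where
  "weak_star_limit X \<mu> \<nu> \<longleftrightarrow>
     (\<forall>\<phi> :: 'a \<Rightarrow> complex. continuous_on X \<phi> \<longrightarrow>
        (\<lambda>k. integral\<^sup>L (\<mu> k) \<phi>) \<longlonglongrightarrow> integral\<^sup>L \<nu> \<phi>)"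

text \<open>
  A Furstenberg system \<open>(X_f, \<nu>, S)\<close> is determined by its measure \<open>\<nu>\<close>.
\<close>

definition furstenberg_system :: "(nat \<Rightarrow> complex) \<Rightarrow> (int \<Rightarrow> complex) measure \<Rightarrow> bool" where
  "furstenberg_system f \<nu> \<longleftrightarrow>
     borel_prob_on (orbit_closure f) \<nu> \<and>
     (\<exists>N :: nat \<Rightarrow> nat. filterlim N at_top sequentially \<and>
        weak_star_limit (orbit_closure f) (\<lambda>k. empirical_measure f (N k)) \<nu>)"

definition has_unique_furstenberg_system :: "(nat \<Rightarrow> complex) \<Rightarrow> bool" where
  "has_unique_furstenberg_system f \<longleftrightarrow>
     (\<exists>\<nu>. borel_prob_on (orbit_closure f) \<nu> \<and>
          weak_star_limit (orbit_closure f) (empirical_measure f) \<nu>)"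

lemma closed_orbit_closure: "closed (orbit_closure f)"
  by (simp add: orbit_closure_def)

lemma shift_in_orbit_closure: "left_shift n (extend_by_zero f) \<in> orbit_closure f"
  unfolding orbit_closure_def by (rule subsetD[OF closure_subset]) (rule rangeI)

lemma integral_empirical_measure:
  fixes \<phi> :: "(int \<Rightarrow> complex) \<Rightarrow> complex"
  assumes "continuous_on (orbit_closure f) \<phi>"
  shows "integral\<^sup>L (empirical_measure f N) \<phi> =
         (1 / of_nat N) * (\<Sum>n=1..N. \<phi> (left_shift (int n) (extend_by_zero f)))"
proof -
  have "integral\<^sup>L (empirical_measure f N) \<phi> =
     integral\<^sup>L (uniform_count_measure {1..N}) (\<lambda>n. \<phi> (left_shift (int n) (extend_by_zero f)))"
    unfolding empirical_measure_def
  proof (rule integral_distr)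
    show "(\<lambda>n. left_shift (int n) (extend_by_zero f))
            \<in> uniform_count_measure {1..N} \<rightarrow>\<^sub>M restrict_space borel (orbit_closure f)"
      by (rule measurableI)
        (simp_all add: space_uniform_count_measure sets_uniform_count_measure
          space_restrict_space shift_in_orbit_closure)
    show "\<phi> \<in> borel_measurable (restrict_space borel (orbit_closure f))"
      using assms by (rule borel_measurable_continuous_on_restrict)
  qed
  also have "\<dots> = (\<Sum>n\<in>{1..N}. (1 / real (card {1..N})) *\<^sub>R \<phi> (left_shift (int n) (extend_by_zero f)))"
    unfolding uniform_count_measure_def
    by (rule lebesgue_integral_point_measure_finite) simp_all
  also have "\<dots> = (1 / of_nat N) * (\<Sum>n=1..N. \<phi> (left_shift (int n) (extend_by_zero f)))"
    by (simp only: scaleR_conv_of_real sum_distrib_left card_atLeastAtMost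
        diff_Suc_1 Suc_eq_plus1 diff_add_inverse2 of_real_divide of_real_1 of_real_of_nat_eq)
  finally show ?thesis .
qed

lemma has_unique_furstenberg_system_imp_ex:
  assumes "has_unique_furstenberg_system f"
  shows "\<exists>\<nu>. furstenberg_system f \<nu>"
proof -
  obtain \<nu> where "borel_prob_on (orbit_closure f) \<nu>"
    and "weak_star_limit (orbit_closure f) (empirical_measure f) \<nu>"
    using assms unfolding has_unique_furstenberg_system_def by blast
  moreover have "filterlim (\<lambda>k::nat. k) at_top sequentially"
    by (rule filterlim_ident)
  ultimately have "furstenberg_system f \<nu>"
    unfolding furstenberg_system_def by (intro conjI) (assumption, rule exI, erule conjI, assumption)
  then show ?thesis ..
qed

end

theory Submission imports Defs begin

text \<open>
  Truncating to finitely many primes \<open>A \<subseteq> F\<close> and to exponents below \<open>k\<close>, put \<open>P = (\<Prod>p\<in>A. p ^ k)\<close>.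
  Then \<open>f n = f (gcd n P) * chi (n div gcd n P)\<close> unless \<open>p ^ k\<close> divides \<open>n\<close> for some \<open>p \<in> A\<close> or \<open>p\<close>
  divides \<open>n\<close> for some \<open>p \<in> F - A\<close>. The right-hand side is \<open>q * P\<close>-periodic, and the density of the
  exceptional \<open>n\<close> is at most \<open>(\<Sum>p\<in>A. p ^ -k) + (\<Sum>p\<in>F - A. 1 / p)\<close>, which is arbitrarily small.

  The measure of the Furstenberg system of a bounded RAP sequence is the law of an explicit random
  sequence, so that no representation theorem for functionals is needed. A uniformly
  distributed \<open>u \<in> [0, 1)\<close> encodes a random profinite integer, that is, compatible residues
  uniformly distributed modulo \<open>K!\<close> for all \<open>K\<close>, by which every periodic sequence can be shifted.
  The random shifts of periodic approximants \<open>G k\<close> of \<open>f\<close> with errors \<open>2 ^ -k\<close> converge almost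
  surely. By uniform continuity on the compact space of sequences in the unit disc, the averages of
  a continuous function along the orbit of \<open>f\<close> converge to its expectation at the limit.
\<close>

section \<open>Rational almost periodicity by discarding sparse sets of multiples\<close>

lemma card_multiples_le:
  fixes d N :: nat
  assumes "d > 0"
  shows "real (card {n\<in>{1..N}. d dvd n}) \<le> real N / real d"
proof -
  have "{n\<in>{1..N}. d dvd n} \<subseteq> (\<lambda>j. d * j) ` {1..N div d}"
  proof
    fix n assume "n \<in> {n\<in>{1..N}. d dvd n}"
    then obtain j where j: "n = d * j" "1 \<le> n" "n \<le> N" by auto
    with assms have "j \<in> {1..N div d}"
      by (auto simp: less_eq_div_iff_mult_less_eq mult.commute intro!: Suc_leI)
    with j show "n \<in> (\<lambda>j. d * j) ` {1..N div d}" by blast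
  qed
  then have "card {n\<in>{1..N}. d dvd n} \<le> card ((\<lambda>j. d * j) ` {1..N div d})"
    by (intro card_mono) auto
  also have "\<dots> \<le> N div d"
    using card_image_le[of "{1..N div d}" "\<lambda>j. d * j"] by simp
  finally have "real (card {n\<in>{1..N}. d dvd n}) \<le> real (N div d)"
    by (simp only: of_nat_le_iff)
  also have "\<dots> \<le> real N / real d" by (rule of_nat_div_le_of_nat)
  finally show ?thesis .
qed

lemma card_UN_multiples_le:
  fixes d :: "'a \<Rightarrow> nat"
  assumes "finite B" "\<And>p. p \<in> B \<Longrightarrow> d p > 0"
  shows "real (card {n\<in>{1..N}. \<exists>p\<in>B. d p dvd n}) \<le> real N * (\<Sum>p\<in>B. 1 / real (d p))"
proof -
  have "{n\<in>{1..N}. \<exists>p\<in>B. d p dvd n} = (\<Union>p\<in>B. {n\<in>{1..N}. d p dvd n})"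
    by auto
  then have "card {n\<in>{1..N}. \<exists>p\<in>B. d p dvd n} \<le> (\<Sum>p\<in>B. card {n\<in>{1..N}. d p dvd n})"
    using card_UN_le[OF assms(1), of "\<lambda>p. {n\<in>{1..N}. d p dvd n}"] by simp
  then have "real (card {n\<in>{1..N}. \<exists>p\<in>B. d p dvd n})
      \<le> (\<Sum>p\<in>B. real (card {n\<in>{1..N}. d p dvd n}))"
    by (simp only: of_nat_sum[symmetric] of_nat_le_iff)
  also have "\<dots> \<le> (\<Sum>p\<in>B. real N / real (d p))"
    by (rule sum_mono) (rule card_multiples_le, rule assms(2))
  also have "\<dots> = real N * (\<Sum>p\<in>B. 1 / real (d p))"
    by (simp add: sum_distrib_left)
  finally show ?thesis .
qed

text \<open>The sums over \<open>A\<close> and over \<open>A \<union> B\<close> both lie within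
  \<open>\<delta> / 2\<close> of the total, and they differ by the sum over \<open>B\<close>. This
  selects the finitely many primes that the periodic approximant takes into account.\<close>

lemma summable_on_tail_small:
  fixes h :: "'a \<Rightarrow> real"
  assumes "h summable_on F" "\<delta> > 0"
  obtains A where "finite A" "A \<subseteq> F" "\<And>B. finite B \<Longrightarrow> B \<subseteq> F - A \<Longrightarrow> sum h B \<le> \<delta>"
proof -
  obtain S where "(h has_sum S) F" using assms(1) by (auto simp: summable_on_def)
  then have "\<forall>\<^sub>F B in finite_subsets_at_top F. dist (sum h B) S < \<delta> / 2"
    unfolding has_sum_def using assms(2) by (intro tendstoD) auto
  then obtain A where A: "finite A" "A \<subseteq> F"
    and close: "\<forall>B. finite B \<and> A \<subseteq> B \<and> B \<subseteq> F \<longrightarrow> dist (sum h B) S < \<delta> / 2"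
    unfolding eventually_finite_subsets_at_top by (elim exE conjE) (rule that)
  have "sum h B \<le> \<delta>" if "finite B" "B \<subseteq> F - A" for B
  proof -
    have "sum h (A \<union> B) = sum h A + sum h B"
      using that A by (intro sum.union_disjoint) auto
    moreover have "dist (sum h (A \<union> B)) S < \<delta> / 2" "dist (sum h A) S < \<delta> / 2"
      using close A that by auto
    ultimately show ?thesis by (auto simp: dist_real_def abs_if split: if_splits)
  qed
  with A that show thesis by blast
qed

lemma periodic_add_mult:
  fixes g :: "nat \<Rightarrow> 'a"
  assumes "\<And>n. g (n + q) = g n"
  shows "g (n + j * q) = g n"
proof (induction j)
  case (Suc j)
  then show ?case using assms[of "n + j * q"] by (simp add: ac_simps)
qed simp

lemma periodic_bounded:
  fixes g :: "nat \<Rightarrow> 'a::real_normed_vector"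
  assumes "q > 0" "\<And>n. g (n + q) = g n"
  obtains B where "B \<ge> 0" "\<And>n. norm (g n) \<le> B"
proof -
  have "range g \<subseteq> g ` {..<q}"
  proof
    fix y assume "y \<in> range g"
    then obtain n where "y = g (n mod q + n div q * q)" by auto
    then have "y = g (n mod q)" by (simp only: periodic_add_mult[of g q, OF assms(2)])
    with assms(1) show "y \<in> g ` {..<q}" by auto
  qed
  then have "bounded (range g)"
    by (meson finite_imageI finite_imp_bounded finite_lessThan finite_subset)
  then obtain B where "\<And>n. norm (g n) \<le> B" by (auto simp: bounded_iff)
  moreover from this have "B \<ge> 0" by (meson norm_ge_zero order_trans)
  ultimately show thesis using that by blast
qed

text \<open>As the exponent in \<open>n\<close> of each \<open>p \<in> A\<close> stays below
  \<open>k\<close>, the gcd with \<open>P\<close> absorbs the whole \<open>p\<close>-part of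
  \<open>n\<close>. The cofactor is then free of primes of \<open>F\<close>, so \<open>f\<close>
  agrees with \<open>chi\<close> there, and it is coprime to the gcd, whose prime factors all lie in
  \<open>A\<close>.\<close>

lemma eq_gcd_split:
  assumes f: "f \<in> class_M" and F: "\<forall>p\<in>F. prime p"
    and fchi: "\<forall>n>0. (\<forall>p\<in>F. coprime n p) \<longrightarrow> f n = chi n"
    and A: "finite A" "A \<subseteq> F" and P: "P = (\<Prod>p\<in>A. p ^ k)"
    and n: "n > 0" "\<forall>p\<in>A. \<not> p ^ k dvd n" "\<forall>p\<in>F - A. \<not> p dvd n"
  shows "f n = f (gcd n P) * chi (n div gcd n P)"
proof -
  define g where "g = gcd n P"
  have nz: "n = g * (n div g)" "g > 0" "n div g > 0"
    using n(1) by (auto simp: g_def div_greater_zero_iff gcd_le1_nat)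
  have cop: "\<not> p dvd n div g" if "p \<in> F" for p
  proof
    assume dvd: "p dvd n div g"
    have p: "prime p" using F that by blast
    have "p dvd n" using dvd nz(1) by (metis dvd_mult)
    with n(3) that have "p \<in> A" by blast
    then have pk: "p ^ k dvd P" unfolding P by (rule dvd_prodI[OF A(1)])
    \<comment> \<open>The full power \<open>p ^ j\<close> in \<open>n\<close> already divides the
      gcd because \<open>j < k\<close>; a further factor \<open>p\<close> in the cofactor would make
      \<open>p ^ Suc j\<close> divide \<open>n\<close>.\<close>
    define j where "j = multiplicity p n"
    have "p ^ j dvd n" unfolding j_def by (rule multiplicity_dvd)
    have "j < k"
    proof (rule ccontr)
      assume "\<not> j < k"
      then have "p ^ k dvd n" using \<open>p ^ j dvd n\<close> by (meson le_imp_power_dvd not_less dvd_trans)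
      with n(2) \<open>p \<in> A\<close> show False by blast
    qed
    then have "p ^ j dvd g"
      unfolding g_def using pk \<open>p ^ j dvd n\<close>
      by (meson gcd_greatest le_imp_power_dvd less_imp_le dvd_trans)
    then have "p ^ j * p dvd g * (n div g)" using dvd by (rule mult_dvd_mono)
    then have "p ^ Suc j dvd n" by (simp only: nz(1)[symmetric] power_Suc2)
    then have "Suc j \<le> multiplicity p n"
      using n(1) p not_prime_unit by (intro multiplicity_geI) auto
    then show False by (simp add: j_def)
  qed
  have "coprime g (n div g)"
  proof (rule ccontr)
    assume "\<not> coprime g (n div g)"
    then obtain r where r: "prime r" "r dvd g" "r dvd n div g"
      using nz(2) by (metis coprime_iff_gcd_eq_1 gcd_greatest_iff gcd_pos_nat prime_factor_nat)
    then have "r dvd P" unfolding g_def by (meson gcd_dvd2 dvd_trans)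
    then obtain p where "p \<in> A" "r dvd p ^ k"
      unfolding P prime_dvd_prod_iff[OF A(1) r(1)] by blast
    then have "r = p"
      using prime_dvd_power[OF r(1)] primes_dvd_imp_eq[OF r(1)] F A(2) by blast
    with cop \<open>p \<in> A\<close> A(2) r(3) show False by blast
  qed
  then have "f (g * (n div g)) = f g * f (n div g)"
    using f nz(2,3) unfolding class_M_def by blast
  then have "f n = f g * f (n div g)" using nz(1) by metis
  moreover have "coprime (n div g) p" if "p \<in> F" for p
    using cop[OF that] F that prime_imp_coprime coprime_commute by blast
  then have "f (n div g) = chi (n div g)" using fchi nz(3) by blast
  ultimately show ?thesis unfolding g_def by simp
qed

lemma RAP_of_eq_character:
  assumes f: "f \<in> class_M" and chi: "dirichlet_character q chi"
    and F: "\<forall>p\<in>F. prime p" and summable: "(\<lambda>p. 1 / real p) summable_on F"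
    and fchi: "\<forall>n>0. (\<forall>p\<in>F. coprime n p) \<longrightarrow> f n = chi n"
  shows "RAP f"
  unfolding RAP_def
proof (intro allI impI)
  fix \<epsilon> :: real assume "\<epsilon> > 0"
  have q: "q > 0" and per: "\<And>n. chi (n + q) = chi n"
    using chi by (auto simp: dirichlet_character_def)
  have per': "chi (n + j * q) = chi n" for n j
    by (rule periodic_add_mult) (rule per)
  obtain B where B: "B \<ge> 0" "\<And>n. norm (chi n) \<le> B"
    using periodic_bounded[of q chi, OF q per] by blast
  \<comment> \<open>The sets \<open>E1\<close> and \<open>E2\<close> below each have at most
    \<open>real N * \<delta>\<close> elements, and \<open>f\<close> and \<open>g\<close> differ by
    at most \<open>1 + B\<close> on them. The total is \<open>\<epsilon> / 2\<close>, which leaves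
    room for the strict inequality on the limsup.\<close>
  define \<delta> where "\<delta> = \<epsilon> / (4 * (1 + B))"
  have \<delta>: "\<delta> > 0" "(1 + B) * (2 * \<delta>) = \<epsilon> / 2"
    using \<open>\<epsilon> > 0\<close> B(1) by (auto simp: \<delta>_def field_simps)
  obtain A where A: "finite A" "A \<subseteq> F"
    and tail: "\<And>B. finite B \<Longrightarrow> B \<subseteq> F - A \<Longrightarrow> (\<Sum>p\<in>B. 1 / real p) \<le> \<delta>"
    using summable_on_tail_small[OF summable \<delta>(1)] by blast
  have "((\<lambda>k. \<Sum>p\<in>A. (1 / real p) ^ k) \<longlongrightarrow> (\<Sum>p\<in>A. 0)) sequentially"
  proof (intro tendsto_sum LIMSEQ_power_zero)
    fix p assume "p \<in> A"
    then have "p > 1" using A(2) F prime_gt_1_nat by blast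
    then show "norm (1 / real p) < 1" by simp
  qed
  then have "\<forall>\<^sub>F k in sequentially. (\<Sum>p\<in>A. (1 / real p) ^ k) < \<delta>"
    using \<delta>(1) by (intro order_tendstoD) auto
  then obtain k where k: "(\<Sum>p\<in>A. (1 / real p) ^ k) < \<delta>"
    by (auto dest: eventually_happens)
  define P where "P = (\<Prod>p\<in>A. p ^ k)"
  have pos: "p > 0" if "p \<in> F" for p using F that prime_gt_0_nat by blast
  have "P > 0" unfolding P_def using pos A(2) by (intro prod_pos) auto
  define g where "g = (\<lambda>n. f (gcd n P) * chi (n div gcd n P))"
  \<comment> \<open>Adding \<open>q * P\<close> preserves the gcd with \<open>P\<close> and moves
    the quotient by the multiple \<open>(P div gcd n P) * q\<close> of the period of
    \<open>chi\<close>.\<close>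
  have "g (n + q * P) = g n" for n
  proof -
    have "gcd (n + q * P) P = gcd n P"
      by (metis add.commute gcd.commute gcd_add_mult)
    moreover have "(n + q * P) div gcd n P = n div gcd n P + (P div gcd n P) * q"
      by (metis div_plus_div_distrib_dvd_left div_mult_swap gcd_dvd1 gcd_dvd2 mult.commute)
    ultimately show ?thesis by (simp add: g_def per')
  qed
  then have "periodic_seq g"
    unfolding periodic_seq_def using q \<open>P > 0\<close> by (metis nat_0_less_mult_iff)
  have fle: "norm (f n) \<le> 1" if "n > 0" for n
    using f that by (auto simp: class_M_def)
  have gle: "norm (g n) \<le> B" for n
  proof -
    have "norm (g n) \<le> 1 * B"
      unfolding g_def norm_mult using fle[of "gcd n P"] B \<open>P > 0\<close> by (intro mult_mono) auto
    then show ?thesis by simp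
  qed
  have "(\<Sum>n\<in>{1..<N}. norm (f n - g n)) \<le> real N * (\<epsilon> / 2)" for N
  proof -
    define E1 where "E1 = {n\<in>{1..N}. \<exists>p\<in>A. p ^ k dvd n}"
    \<comment> \<open>Cutting off at \<open>N\<close> makes the set of primes finite and loses
      nothing, as a divisor of some \<open>n \<le> N\<close> is at most \<open>N\<close>.\<close>
    define E2 where "E2 = {n\<in>{1..N}. \<exists>p\<in>(F - A) \<inter> {..N}. p dvd n}"
    have "real (card E1) \<le> real N * (\<Sum>p\<in>A. 1 / real (p ^ k))"
      unfolding E1_def using A pos by (intro card_UN_multiples_le) auto
    also have "\<dots> \<le> real N * \<delta>"
      using k by (intro mult_left_mono) (simp_all add: power_one_over)
    finally have E1: "real (card E1) \<le> real N * \<delta>" .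
    have "real (card E2) \<le> real N * (\<Sum>p\<in>(F - A) \<inter> {..N}. 1 / real p)"
      unfolding E2_def using pos by (intro card_UN_multiples_le) auto
    also have "\<dots> \<le> real N * \<delta>"
      by (intro mult_left_mono tail) auto
    finally have E2: "real (card E2) \<le> real N * \<delta>" .
    have out: "norm (f n - g n) \<le> (if n \<in> E1 \<union> E2 then 1 + B else 0)" if "n \<in> {1..N}" for n
    proof (cases "n \<in> E1 \<union> E2")
      case True
      have "norm (f n - g n) \<le> norm (f n) + norm (g n)" by (rule norm_triangle_ineq4)
      with True fle[of n] gle[of n] that show ?thesis by simp
    next
      case False
      have "\<not> p dvd n" if "p \<in> F - A" for p
        using False that \<open>n \<in> {1..N}\<close> dvd_imp_le[of p n] by (auto simp: E2_def)
      moreover have "\<forall>p\<in>A. \<not> p ^ k dvd n" using False that by (auto simp: E1_def)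
      ultimately have "f n = g n"
        unfolding g_def using that
        by (intro eq_gcd_split[OF f F fchi A P_def]) auto
      with False show ?thesis by simp
    qed
    have fin: "finite E1" "finite E2" "E1 \<union> E2 \<subseteq> {1..N}" by (auto simp: E1_def E2_def)
    have "(\<Sum>n\<in>{1..<N}. norm (f n - g n)) \<le> (\<Sum>n\<in>{1..N}. norm (f n - g n))"
      by (intro sum_mono2) auto
    also have "\<dots> \<le> (\<Sum>n\<in>{1..N}. if n \<in> E1 \<union> E2 then 1 + B else 0)"
      by (intro sum_mono out)
    also have "\<dots> = (1 + B) * real (card (E1 \<union> E2))"
      using fin(3) by (subst sum.inter_restrict[symmetric]) (simp_all add: Int_absorb1)
    also have "\<dots> \<le> (1 + B) * (real N * (2 * \<delta>))"
    proof (intro mult_left_mono)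
      show "real (card (E1 \<union> E2)) \<le> real N * (2 * \<delta>)"
        using E1 E2 card_Un_le[of E1 E2] by (simp add: algebra_simps)
    qed (use B(1) in simp)
    also have "\<dots> = real N * (\<epsilon> / 2)" unfolding \<delta>(2)[symmetric] by (simp only: mult_ac)
    finally show ?thesis .
  qed
  then have "(1 / real N) * (\<Sum>n\<in>{1..<N}. norm (f n - g n)) \<le> \<epsilon> / 2" for N
    using \<open>\<epsilon> > 0\<close> by (cases "N = 0") (auto simp: field_simps)
  then have "limsup (\<lambda>N. ereal ((1 / real N) * (\<Sum>n\<in>{1..<N}. norm (f n - g n)))) \<le> ereal (\<epsilon> / 2)"
    by (intro Limsup_bounded always_eventually allI) simp
  also have "\<dots> < ereal \<epsilon>" using \<open>\<epsilon> > 0\<close> by simp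
  finally show "\<exists>g. periodic_seq g \<and>
      limsup (\<lambda>N. ereal ((1 / real N) * (\<Sum>n\<in>{1..<N}. norm (f n - g n)))) < ereal \<epsilon>"
    using \<open>periodic_seq g\<close> by blast
qed

section \<open>Averages of periodic sequences\<close>

text \<open>Advancing the window by one drops \<open>b N\<close> and gains \<open>b (N + Q)\<close>,
  which are equal.\<close>

lemma periodic_sum_shift:
  fixes b :: "nat \<Rightarrow> 'a::ab_group_add"
  assumes "\<And>n. b (n + Q) = b n"
  shows "(\<Sum>r<Q. b (r + N)) = (\<Sum>r<Q. b r)"
proof (induction N)
  case (Suc N)
  have "(\<Sum>r<Suc Q. b (r + N)) = b N + (\<Sum>r<Q. b (r + Suc N))"
    by (subst sum.lessThan_Suc_shift) simp
  moreover have "(\<Sum>r<Suc Q. b (r + N)) = (\<Sum>r<Q. b (r + N)) + b N"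
    using assms[of N] by (simp add: add.commute)
  ultimately show ?case using Suc by (simp add: add.commute)
qed simp

text \<open>The deviation \<open>s N\<close> of the partial sum from \<open>N\<close> times the mean
  is itself \<open>Q\<close>-periodic, hence bounded, and vanishes after division by
  \<open>N\<close>.\<close>

lemma periodic_average_tendsto:
  fixes b :: "nat \<Rightarrow> 'a::real_normed_vector"
  assumes "Q > 0" and per: "\<And>n. b (n + Q) = b n"
  shows "(\<lambda>N. (1 / real N) *\<^sub>R (\<Sum>n=1..N. b n)) \<longlonglongrightarrow> (1 / real Q) *\<^sub>R (\<Sum>r<Q. b r)"
proof -
  define c where "c = (1 / real Q) *\<^sub>R (\<Sum>r<Q. b r)"
  define s where "s N = (\<Sum>n=1..N. b n) - real N *\<^sub>R c" for N
  have "s (N + Q) = s N" for N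
  proof -
    have "(\<Sum>n=1..N+Q. b n) = (\<Sum>n=1..N. b n) + (\<Sum>n=Suc N..N+Q. b n)"
      using sum.ub_add_nat[of 1 N b Q] by simp
    also have "(\<Sum>n=Suc N..N+Q. b n) = (\<Sum>r<Q. b (r + Suc N))"
      by (rule sum.reindex_bij_witness[of _ "\<lambda>r. r + Suc N" "\<lambda>n. n - Suc N"]) auto
    also have "\<dots> = real Q *\<^sub>R c"
      using \<open>Q > 0\<close> by (simp only: periodic_sum_shift[of b Q, OF per]) (simp add: c_def)
    finally show ?thesis by (simp add: s_def scaleR_left_distrib)
  qed
  then obtain B where B: "\<And>N. norm (s N) \<le> B"
    using periodic_bounded[of Q s] \<open>Q > 0\<close> by metis
  have "(\<lambda>N. (1 / real N) *\<^sub>R s N) \<longlonglongrightarrow> 0"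
  proof (rule Lim_null_comparison)
    show "\<forall>\<^sub>F N in sequentially. norm ((1 / real N) *\<^sub>R s N) \<le> B / real N"
      using B by (intro always_eventually allI) (simp add: divide_right_mono)
    show "(\<lambda>N. B / real N) \<longlonglongrightarrow> 0" by (rule lim_const_over_n)
  qed
  then have "(\<lambda>N. (1 / real N) *\<^sub>R s N + c) \<longlonglongrightarrow> 0 + c" by (intro tendsto_intros)
  then have "(\<lambda>N. (1 / real N) *\<^sub>R s N + c) \<longlonglongrightarrow> c" by simp
  then show ?thesis unfolding c_def[symmetric]
  proof (rule Lim_transform_eventually)
    show "\<forall>\<^sub>F N in sequentially.
        (1 / real N) *\<^sub>R s N + c = (1 / real N) *\<^sub>R (\<Sum>n=1..N. b n)"
      using eventually_gt_at_top[of 0]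
      by eventually_elim (simp add: s_def scaleR_right_diff_distrib)
  qed
qed

section \<open>Continuous functions on the space of sequences in the unit disc\<close>

text \<open>Tychonoff's theorem, transferred from the abstract product topology to the topology of
  the function type.\<close>

lemma compact_unit_polydisc: "compact {x :: 'i \<Rightarrow> complex. \<forall>m. norm (x m) \<le> 1}"
proof -
  have "compactin (product_topology (\<lambda>i::'i. euclidean :: complex topology) UNIV)
      (PiE UNIV (\<lambda>_. cball 0 1))"
    by (subst compactin_PiE) auto
  moreover have "PiE UNIV (\<lambda>_. cball 0 1) = {x :: 'i \<Rightarrow> complex. \<forall>m. norm (x m) \<le> 1}"
    by (auto simp: PiE_def)
  ultimately show ?thesis by (simp add: euclidean_product_topology)
qed

text \<open>If \<open>x\<close> and \<open>y\<close> are close on a finite window of coordinates,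
  uniform continuity gives \<open>\<epsilon>\<close>; otherwise the second summand exceeds the
  trivial bound \<open>2 * C\<close>. Since the bound is linear in the coordinate differences it can
  be averaged along an orbit, so closeness in mean suffices.\<close>

lemma continuous_unit_polydisc_window:
  fixes \<phi> :: "('i::countable \<Rightarrow> complex) \<Rightarrow> 'b::real_normed_vector"
  assumes cont: "continuous_on UNIV \<phi>" and bound: "\<And>x. norm (\<phi> x) \<le> C" and "\<epsilon> > 0"
  shows "\<exists>L\<ge>0. \<exists>I. finite I \<and> (\<forall>x y. (\<forall>m. norm (x m) \<le> 1) \<longrightarrow> (\<forall>m. norm (y m) \<le> 1)
      \<longrightarrow> norm (\<phi> x - \<phi> y) \<le> \<epsilon> + L * (\<Sum>m\<in>I. norm (x m - y m)))"
proof -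
  define D where "D = {x :: 'i \<Rightarrow> complex. \<forall>m. norm (x m) \<le> 1}"
  have "uniformly_continuous_on D \<phi>"
    unfolding D_def using cont compact_unit_polydisc
    by (intro compact_uniformly_continuous) (auto intro: continuous_on_subset)
  then obtain \<delta> where "\<delta> > 0"
    and \<delta>: "\<And>x y. \<lbrakk>x \<in> D; y \<in> D; dist x y < \<delta>\<rbrakk> \<Longrightarrow> dist (\<phi> x) (\<phi> y) < \<epsilon>"
    using \<open>\<epsilon> > 0\<close> unfolding uniformly_continuous_on_def by metis
  \<comment> \<open>The metric of the function space is at most twice the maximal distance in the
    first coordinates plus \<open>(1/2) ^ N\<close>; the tail takes one half of
    \<open>\<delta>\<close> and leaves the other to the window.\<close>
  obtain N where N: "(1/2 :: real) ^ N < \<delta> / 2"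
    using real_arch_pow_inv[of "\<delta> / 2" "1/2"] \<open>\<delta> > 0\<close> by auto
  define I where "I = (from_nat :: nat \<Rightarrow> 'i) ` {..N}"
  have "C \<ge> 0" using bound[of "\<lambda>_. 0"] by (rule order_trans[OF norm_ge_zero])
  \<comment> \<open>Outside the uniform case the window sum is at least \<open>\<delta> / 4\<close>,
    and \<open>L * (\<delta> / 4) = 2 * C\<close>.\<close>
  define L where "L = 8 * C / \<delta>"
  have "norm (\<phi> x - \<phi> y) \<le> \<epsilon> + L * (\<Sum>m\<in>I. norm (x m - y m))"
    if x: "\<And>m. norm (x m) \<le> 1" and y: "\<And>m. norm (y m) \<le> 1" for x y
  proof -
    define s where "s = (\<Sum>m\<in>I. norm (x m - y m))"
    have "s \<ge> 0" unfolding s_def by (intro sum_nonneg) auto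
    have "Max {dist (x (from_nat n)) (y (from_nat n)) |n. n \<le> N} \<le> s"
    proof (rule Max.boundedI)
      fix a assume "a \<in> {dist (x (from_nat n)) (y (from_nat n)) |n. n \<le> N}"
      then obtain n where n: "n \<le> N" "a = dist (x (from_nat n)) (y (from_nat n))" by blast
      then have "from_nat n \<in> I" by (auto simp: I_def)
      then show "a \<le> s"
        unfolding n s_def dist_norm by (intro member_le_sum) (auto simp: I_def)
    qed auto
    then have dist: "dist x y \<le> 2 * s + (1/2) ^ N"
      using dist_fun_le_dist_first_terms[of x y N] by linarith
    show ?thesis
    proof (cases "2 * s < \<delta> / 2")
      case True
      then have "dist (\<phi> x) (\<phi> y) < \<epsilon>" using x y dist N by (intro \<delta>) (auto simp: D_def)
      moreover have "L * s \<ge> 0" using \<open>C \<ge> 0\<close> \<open>\<delta> > 0\<close> \<open>s \<ge> 0\<close> by (simp add: L_def)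
      ultimately show ?thesis by (simp add: dist_norm s_def)
    next
      case False
      have "norm (\<phi> x - \<phi> y) \<le> 2 * C"
        using norm_triangle_ineq4[of "\<phi> x" "\<phi> y"] bound[of x] bound[of y] by linarith
      also have "\<dots> = L * (\<delta> / 4)" using \<open>\<delta> > 0\<close> by (simp add: L_def)
      also have "\<dots> \<le> L * s"
        using False \<open>C \<ge> 0\<close> \<open>\<delta> > 0\<close> by (intro mult_left_mono) (auto simp: L_def)
      finally show ?thesis using \<open>\<epsilon> > 0\<close> by (simp add: s_def)
    qed
  qed
  then have "\<forall>x y. (\<forall>m. norm (x m) \<le> 1) \<longrightarrow> (\<forall>m. norm (y m) \<le> 1)
      \<longrightarrow> norm (\<phi> x - \<phi> y) \<le> \<epsilon> + L * (\<Sum>m\<in>I. norm (x m - y m))"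
    by blast
  moreover have "L \<ge> 0" "finite I"
    using \<open>C \<ge> 0\<close> \<open>\<delta> > 0\<close> by (simp_all add: L_def I_def)
  ultimately show ?thesis by blast
qed

section \<open>Periodic approximants on the integers\<close>

text \<open>Projection onto the closed unit disc is 1-Lipschitz and fixes the values of
  \<open>f\<close>, so it bounds the approximant without enlarging the error. Any period
  \<open>q\<close> divides \<open>fact q\<close>; factorials form a chain under divisibility, so
  that a single compatible system of residues serves all approximants.\<close>

lemma RAP_approximant:
  assumes "RAP f" and f: "\<And>n. n > 0 \<Longrightarrow> norm (f n) \<le> 1" and "\<epsilon> > 0"
  obtains G :: "int \<Rightarrow> complex" and K :: nat
  where "\<And>m. norm (G m) \<le> 1" "\<And>m. G (m + fact K) = G m"
    "\<forall>\<^sub>F N in sequentially. (\<Sum>n\<in>{1..<N}. norm (f n - G (int n))) \<le> \<epsilon> * real N"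
proof -
  obtain g where "periodic_seq g"
    and lim: "limsup (\<lambda>N. ereal ((1 / real N) * (\<Sum>n\<in>{1..<N}. norm (f n - g n)))) < ereal \<epsilon>"
    using assms unfolding RAP_def by blast
  then obtain q where q: "q > 0" and per: "\<And>n. g (n + q) = g n"
    unfolding periodic_seq_def by blast
  define G where "G m = closest_point (cball 0 1) (g (nat (m mod int q)))" for m
  have "norm (G m) \<le> 1" for m
    using closest_point_in_set[of "cball (0::complex) 1"] by (auto simp: G_def)
  moreover have "G (m + fact q) = G m" for m
  proof -
    have "int q dvd fact q" using q
      by (metis dvd_fact int_dvd_int_iff le_refl of_nat_fact One_nat_def Suc_leI)
    then have "(m + fact q) mod int q = m mod int q" by (elim dvdE) simp
    then show ?thesis by (simp add: G_def)
  qed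
  moreover have close: "norm (f n - G (int n)) \<le> norm (f n - g n)" if "n > 0" for n
  proof -
    have "g (n mod q) = g (n mod q + n div q * q)"
      by (rule periodic_add_mult[of g q, OF per, symmetric])
    then have "G (int n) = closest_point (cball 0 1) (g n)"
      by (simp add: G_def nat_mod_distrib)
    moreover have "f n = closest_point (cball 0 1) (f n)"
      using f[OF that] by (intro closest_point_self[symmetric]) simp
    ultimately show ?thesis
      using closest_point_lipschitz[of "cball 0 1" "f n" "g n"] by (simp add: dist_norm)
  qed
  moreover have "\<forall>\<^sub>F N in sequentially. (\<Sum>n\<in>{1..<N}. norm (f n - G (int n))) \<le> \<epsilon> * real N"
    using Limsup_lessD[OF lim] eventually_gt_at_top[of 0]
  proof eventually_elim
    case (elim N)
    have "(\<Sum>n\<in>{1..<N}. norm (f n - G (int n))) \<le> (\<Sum>n\<in>{1..<N}. norm (f n - g n))"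
      by (intro sum_mono close) auto
    also have "\<dots> \<le> \<epsilon> * real N" using elim by (simp add: field_simps)
    finally show ?case .
  qed
  ultimately show thesis using that by blast
qed

text \<open>A shift by \<open>m\<close> moves the range of summation by a bounded amount. The
  boundary terms cost a constant, which the second \<open>\<epsilon> * real N\<close> absorbs for
  large \<open>N\<close>.\<close>

lemma shifted_average_le:
  assumes f: "\<And>n. n > 0 \<Longrightarrow> norm (f n) \<le> 1" and G: "\<And>m. norm (G m) \<le> 1" and "\<epsilon> > 0"
    and ev: "\<forall>\<^sub>F N in sequentially. (\<Sum>n\<in>{1..<N}. norm (f n - G (int n))) \<le> \<epsilon> * real N"
  shows "\<forall>\<^sub>F N in sequentially.
    (\<Sum>n=1..N. norm (extend_by_zero f (int n + m) - G (int n + m))) \<le> 2 * \<epsilon> * real N"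
proof -
  define h where "h j = norm (extend_by_zero f j - G j)" for j
  have h: "0 \<le> h j" "h j \<le> 2" for j
  proof -
    have "norm (extend_by_zero f j) \<le> 1" using f by (simp add: extend_by_zero_def)
    then show "h j \<le> 2"
      using norm_triangle_ineq4[of "extend_by_zero f j" "G j"] G[of j] unfolding h_def by linarith
  qed (simp add: h_def)
  \<comment> \<open>With the added one, \<open>M\<close> counts the indices from
    \<open>-\<bar>m\<bar>\<close> to \<open>0\<close>, and \<open>n + m\<close> stays strictly below
    \<open>N + M\<close> for \<open>n \<le> N\<close>.\<close>
  define M where "M = nat \<bar>m\<bar> + 1"
  obtain N0 where N0: "\<And>N. N \<ge> N0 \<Longrightarrow> (\<Sum>n\<in>{1..<N}. norm (f n - G (int n))) \<le> \<epsilon> * real N"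
    using ev unfolding eventually_sequentially by blast
  \<comment> \<open>The share \<open>\<epsilon> * real M\<close> comes from lengthening the range to
    \<open>N + M\<close>, the share \<open>2 * real M\<close> from the indices up to
    \<open>0\<close>, where \<open>h\<close> is at most 2.\<close>
  have "(\<Sum>n=1..N. h (int n + m)) \<le> \<epsilon> * real N + (\<epsilon> + 2) * real M" if "N \<ge> N0" for N
  proof -
    have "(\<Sum>n=1..N. h (int n + m)) = (\<Sum>j\<in>(\<lambda>n. int n + m) ` {1..N}. h j)"
      by (subst sum.reindex) (auto simp: inj_on_def)
    also have "\<dots> \<le> (\<Sum>j\<in>{-\<bar>m\<bar>..0} \<union> int ` {1..<N + M}. h j)"
    proof (rule sum_mono2)
      show "(\<lambda>n. int n + m) ` {1..N} \<subseteq> {-\<bar>m\<bar>..0} \<union> int ` {1..<N + M}"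
      proof
        fix j assume "j \<in> (\<lambda>n. int n + m) ` {1..N}"
        then obtain n where n: "1 \<le> n" "n \<le> N" "j = int n + m" by auto
        show "j \<in> {-\<bar>m\<bar>..0} \<union> int ` {1..<N + M}"
        proof (cases "j \<le> 0")
          case False
          then have "j = int (nat j)" "nat j \<in> {1..<N + M}" using n by (auto simp: M_def)
          then show ?thesis by blast
        qed (use n in auto)
      qed
    qed (use h in auto)
    also have "\<dots> = (\<Sum>j\<in>{-\<bar>m\<bar>..0}. h j) + (\<Sum>j\<in>int ` {1..<N + M}. h j)"
      by (intro sum.union_disjoint) auto
    also have "(\<Sum>j\<in>int ` {1..<N + M}. h j) = (\<Sum>n\<in>{1..<N + M}. norm (f n - G (int n)))"
      by (subst sum.reindex) (auto simp: h_def extend_by_zero_def intro!: sum.cong)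
    also have "\<dots> \<le> \<epsilon> * real (N + M)" using that by (intro N0) simp
    also have "(\<Sum>j\<in>{-\<bar>m\<bar>..0}. h j) \<le> (\<Sum>j\<in>{-\<bar>m\<bar>..0}. 2)"
      by (intro sum_mono h)
    also have "\<dots> = 2 * real M" by (simp add: M_def)
    finally show ?thesis by (simp add: algebra_simps)
  qed
  moreover obtain N1 where N1: "(\<epsilon> + 2) * real M / \<epsilon> \<le> real N1" using real_arch_simple by blast
  have "(\<epsilon> + 2) * real M \<le> \<epsilon> * real N" if "N \<ge> N1" for N
  proof -
    have "(\<epsilon> + 2) * real M / \<epsilon> \<le> real N" using N1 that by linarith
    then show ?thesis using \<open>\<epsilon> > 0\<close> by (simp add: pos_divide_le_eq mult.commute)
  qed
  ultimately have "(\<Sum>n=1..N. h (int n + m)) \<le> 2 * \<epsilon> * real N" if "N \<ge> max N0 N1" for N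
    using that by fastforce
  then show ?thesis unfolding eventually_sequentially h_def by blast
qed

section \<open>A random profinite integer read off from a uniform real number\<close>

text \<open>
  Reversing the order of the digits in the factorial number system turns the leading digits of a
  real number, which refine by appending a last digit, into residues modulo \<open>K!\<close> that refine
  compatibly.
\<close>

primrec factorial_radix_reversal :: "nat \<Rightarrow> nat \<Rightarrow> nat" where
  "factorial_radix_reversal 0 j = 0"
| "factorial_radix_reversal (Suc K) j =
    factorial_radix_reversal K (j div Suc K) + fact K * (j mod Suc K)"

lemma factorial_radix_reversal_less: "factorial_radix_reversal K j < fact K"
proof (induction K arbitrary: j)
  case (Suc K)
  have "factorial_radix_reversal (Suc K) j < fact K + fact K * (j mod Suc K)"
    using Suc[of "j div Suc K"] by simp
  also have "\<dots> = fact K * Suc (j mod Suc K)" by simp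
  also have "\<dots> \<le> fact K * Suc K" by (intro mult_left_mono) (auto simp: Suc_le_eq)
  finally show ?case by (simp add: algebra_simps)
qed simp

text \<open>No digit is lost: remainder and quotient by \<open>fact K\<close> separate the reversal
  of the leading digits from the last digit, and induction recovers the leading ones.\<close>

lemma inj_on_factorial_radix_reversal: "inj_on (factorial_radix_reversal K) {..<fact K}"
proof (induction K)
  case (Suc K)
  show ?case
  proof (rule inj_onI)
    fix i j assume ij: "i \<in> {..<fact (Suc K)}" "j \<in> {..<fact (Suc K)}"
      and eq: "factorial_radix_reversal (Suc K) i = factorial_radix_reversal (Suc K) j"
    have less: "factorial_radix_reversal K l < fact K" for l by (rule factorial_radix_reversal_less)
    have "factorial_radix_reversal K (i div Suc K) = factorial_radix_reversal K (j div Suc K)"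
      using arg_cong[OF eq, of "\<lambda>n. n mod fact K"] less by simp
    moreover have "i div Suc K < fact K" "j div Suc K < fact K"
      using ij by (auto simp: less_mult_imp_div_less mult.commute)
    ultimately have "i div Suc K = j div Suc K"
      using Suc by (auto dest: inj_onD)
    moreover have "i mod Suc K = j mod Suc K"
      using arg_cong[OF eq, of "\<lambda>n. n div fact K"] less by simp
    ultimately show "i = j" by (metis div_mult_mod_eq)
  qed
qed (simp add: inj_on_def)

text \<open>An injective self-map of a finite set is bijective. This carries the uniform
  distribution from the leading digits to the residues.\<close>

lemma bij_betw_factorial_radix_reversal:
  "bij_betw (factorial_radix_reversal K) {..<fact K} {..<fact K}"
proof -
  have "factorial_radix_reversal K ` {..<fact K} \<subseteq> {..<fact K}"
    using factorial_radix_reversal_less by auto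
  then show ?thesis
    using inj_on_factorial_radix_reversal by (auto simp: bij_betw_def endo_inj_surj)
qed

text \<open>The floor numbers the cells of length \<open>1 / fact K\<close>. Without the reversal,
  the values for \<open>K\<close> and \<open>Suc K\<close> would be related by division instead of
  by congruence.\<close>

definition unit_interval_residue :: "nat \<Rightarrow> real \<Rightarrow> nat" where
  "unit_interval_residue K u = factorial_radix_reversal K (nat \<lfloor>u * fact K\<rfloor>)"

text \<open>Refining the cells appends a last digit to the floor; the reversal gives this digit the
  weight \<open>fact K\<close>, so it disappears modulo \<open>fact K\<close>.\<close>

lemma unit_interval_residue_Suc:
  assumes "u \<ge> 0"
  shows "unit_interval_residue (Suc K) u mod fact K = unit_interval_residue K u mod fact K"
proof -
  have "\<lfloor>u * fact K\<rfloor> = \<lfloor>u * fact (Suc K) / real_of_int (int (Suc K))\<rfloor>"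
    by (simp add: field_simps del: of_nat_Suc)
  also have "\<dots> = \<lfloor>u * fact (Suc K)\<rfloor> div int (Suc K)"
    by (rule floor_divide_real_eq_div) simp
  finally have "nat \<lfloor>u * fact K\<rfloor> = nat \<lfloor>u * fact (Suc K)\<rfloor> div Suc K"
    using assms by (simp add: nat_div_distrib del: of_nat_Suc fact_Suc)
  then show ?thesis by (simp add: unit_interval_residue_def del: fact_Suc)
qed

lemma unit_interval_residue_mod:
  assumes "K \<le> L" "u \<ge> 0"
  shows "unit_interval_residue L u mod fact K = unit_interval_residue K u mod fact K"
  using assms(1)
proof (induction L rule: dec_induct)
  case (step L)
  have "(fact K :: nat) dvd fact L" using step by (intro fact_dvd) simp
  then have "unit_interval_residue (Suc L) u mod fact K = unit_interval_residue L u mod fact K"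
    using unit_interval_residue_Suc[OF assms(2), of L] by (metis mod_mod_cancel)
  with step show ?case by simp
qed simp

text \<open>Excluding the right endpoint keeps the floor of \<open>u * fact K\<close> below
  \<open>fact K\<close>.\<close>

definition unit_interval_measure :: "real measure" where
  "unit_interval_measure = restrict_space lborel {0..<1}"

lemma space_unit_interval_measure [simp]: "space unit_interval_measure = {0..<1}"
  by (simp add: unit_interval_measure_def space_restrict_space)

lemma prob_space_unit_interval_measure: "prob_space unit_interval_measure"
  by (rule prob_spaceI)
    (simp add: unit_interval_measure_def space_restrict_space emeasure_restrict_space)

lemma measurable_unit_interval_residue [measurable]:
  "unit_interval_residue K \<in> unit_interval_measure \<rightarrow>\<^sub>M count_space UNIV"
proof -
  have "(\<lambda>u::real. \<lfloor>u * fact K\<rfloor>) \<in> borel \<rightarrow>\<^sub>M count_space UNIV"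
    by measurable
  then have "(\<lambda>u::real. factorial_radix_reversal K (nat \<lfloor>u * fact K\<rfloor>)) \<in> borel \<rightarrow>\<^sub>M count_space UNIV"
    by (rule measurable_compose[where g = "\<lambda>i. factorial_radix_reversal K (nat i)"])
      (rule measurable_count_space)
  then show ?thesis
    unfolding unit_interval_measure_def unit_interval_residue_def
    by (intro measurable_restrict_space1) simp
qed

text \<open>On each cell \<open>J j\<close>, of measure \<open>1 / fact K\<close>, the residue is
  constantly the reversal of \<open>j\<close>; the bijectivity of the reversal turns the sum over
  cells into a sum over residues.\<close>

lemma integral_unit_interval_residue:
  fixes h :: "nat \<Rightarrow> 'b::{banach, second_countable_topology}"
  shows "integral\<^sup>L unit_interval_measure (\<lambda>u. h (unit_interval_residue K u))
    = (1 / fact K) *\<^sub>R (\<Sum>r<fact K. h r)"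
proof -
  interpret prob_space unit_interval_measure by (rule prob_space_unit_interval_measure)
  define J where "J j = {real j / fact K..<(real j + 1) / fact K}" for j
  have sub: "J j \<subseteq> {0..<1}" if "j < fact K" for j
  proof -
    have "real j + 1 \<le> fact K" using that
      by (metis Suc_leI of_nat_Suc of_nat_fact of_nat_le_iff add.commute)
    then show ?thesis by (auto simp: J_def field_simps less_le_trans intro: order_trans[rotated])
  qed
  have sets: "J j \<in> sets unit_interval_measure" if "j < fact K" for j
    using sub[OF that] by (auto simp: unit_interval_measure_def sets_restrict_space_iff J_def)
  have meas: "measure unit_interval_measure (J j) = 1 / fact K" if "j < fact K" for j
    using sub[OF that]
    by (simp add: unit_interval_measure_def measure_restrict_space)
      (simp add: J_def divide_right_mono diff_divide_distrib[symmetric])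
  have mem: "u \<in> J j \<longleftrightarrow> nat \<lfloor>u * fact K\<rfloor> = j" if "u \<in> {0..<1}" for u j
  proof -
    have "nat \<lfloor>u * fact K\<rfloor> = j \<longleftrightarrow> \<lfloor>u * fact K\<rfloor> = int j" using that by auto
    also have "\<dots> \<longleftrightarrow> u \<in> J j" by (auto simp: floor_eq_iff J_def field_simps)
    finally show ?thesis by simp
  qed
  have "h (unit_interval_residue K u)
      = (\<Sum>j<fact K. indicator (J j) u *\<^sub>R h (factorial_radix_reversal K j))"
    if "u \<in> {0..<1}" for u
  proof -
    have "u * fact K < fact K" using that by simp
    then have "nat \<lfloor>u * fact K\<rfloor> < fact K"
      using that by (metis (no_types, lifting) atLeastLessThan_iff fact_ge_zero floor_less_iff
        mult_nonneg_nonneg nat_less_iff of_int_of_nat_eq of_nat_fact zero_le_floor)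
    moreover have "indicator (J j) u *\<^sub>R h (factorial_radix_reversal K j)
        = (if j = nat \<lfloor>u * fact K\<rfloor> then h (factorial_radix_reversal K j) else 0)" for j
      using mem[OF that, of j] by (auto simp: indicator_def)
    ultimately show ?thesis by (simp add: unit_interval_residue_def)
  qed
  then have "integral\<^sup>L unit_interval_measure (\<lambda>u. h (unit_interval_residue K u))
      = integral\<^sup>L unit_interval_measure
          (\<lambda>u. \<Sum>j<fact K. indicator (J j) u *\<^sub>R h (factorial_radix_reversal K j))"
    by (intro Bochner_Integration.integral_cong) simp_all
  also have "\<dots> = (\<Sum>j<fact K. integral\<^sup>L unit_interval_measure
          (\<lambda>u. indicator (J j) u *\<^sub>R h (factorial_radix_reversal K j)))"
    using sets by (intro Bochner_Integration.integral_sum integrable_scaleR_left)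
      (auto intro: integrable_real_indicator simp: emeasure_eq_measure)
  also have "\<dots> = (\<Sum>j<fact K. (1 / fact K) *\<^sub>R h (factorial_radix_reversal K j))"
  proof (intro sum.cong refl)
    fix j :: nat assume "j \<in> {..<fact K}"
    then have j: "j < fact K" by simp
    have "J j \<inter> {0..<1} = J j" using sub[OF j] by blast
    then show "integral\<^sup>L unit_interval_measure
          (\<lambda>u. indicator (J j) u *\<^sub>R h (factorial_radix_reversal K j))
        = (1 / fact K) *\<^sub>R h (factorial_radix_reversal K j)"
      using sets[OF j] meas[OF j] by (simp add: emeasure_eq_measure)
  qed
  also have "\<dots> = (\<Sum>r<fact K. (1 / fact K) *\<^sub>R h r)"
    by (rule sum.reindex_bij_betw[OF bij_betw_factorial_radix_reversal])
  finally show ?thesis by (simp only: scaleR_sum_right)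
qed

section \<open>Almost sure limit of the randomly shifted approximants\<close>

lemma int_periodic_mod_cong:
  fixes G :: "int \<Rightarrow> 'a"
  assumes per: "\<And>m. G (m + p) = G m" and "a mod p = b mod p"
  shows "G a = G b"
proof -
  have nat: "G (m + int j * p) = G m" for m j
  proof (induction j)
    case (Suc j)
    then show ?case using per[of "m + int j * p"] by (simp add: algebra_simps)
  qed simp
  have "G (m + j * p) = G m" for m j
    using nat[of m "nat j"] nat[of "m + j * p" "nat (- j)"] by (cases "j \<ge> 0") auto
  then have "G (c mod p + c div p * p) = G (c mod p)" for c by blast
  then have "G c = G (c mod p)" for c by simp
  with assms(2) show ?thesis by metis
qed

text \<open>Exchanging sum and integral shows that the sum of the norms of the increments has finite
  expectation, so it is finite almost everywhere. There the increments converge absolutely, and they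
  telescope.\<close>

lemma AE_convergent_of_summable_increments:
  fixes X :: "nat \<Rightarrow> 'a \<Rightarrow> 'b::{banach, second_countable_topology}"
  assumes X: "\<And>k. integrable M (X k)"
    and le: "\<And>k. integral\<^sup>L M (\<lambda>u. norm (X (Suc k) u - X k u)) \<le> c k" and c: "summable c"
  shows "AE u in M. convergent (\<lambda>k. X k u)"
proof -
  have [measurable]: "X k \<in> borel_measurable M" for k using X[of k] by simp
  have int: "integrable M (\<lambda>u. norm (X (Suc k) u - X k u))" for k
    using X by (intro integrable_norm Bochner_Integration.integrable_diff)
  have c0: "0 \<le> c k" for k
    by (rule order_trans[OF Bochner_Integration.integral_nonneg le]) simp
  have "(\<integral>\<^sup>+u. (\<Sum>k. ennreal (norm (X (Suc k) u - X k u))) \<partial>M)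
      = (\<Sum>k. \<integral>\<^sup>+u. ennreal (norm (X (Suc k) u - X k u)) \<partial>M)"
    by (rule nn_integral_suminf) measurable
  also have "\<dots> \<le> (\<Sum>k. ennreal (c k))"
    using int le by (intro suminf_le summableI) (simp add: nn_integral_eq_integral ennreal_leI)
  also have "\<dots> < \<infinity>"
    using ennreal_suminf_neq_top[OF c c0] by (simp add: less_top)
  finally have "AE u in M. (\<Sum>k. ennreal (norm (X (Suc k) u - X k u))) \<noteq> \<infinity>"
    by (intro nn_integral_PInf_AE) auto
  then show ?thesis
  proof eventually_elim
    case (elim u)
    then have "summable (\<lambda>k. norm (X (Suc k) u - X k u))"
      by (intro summable_suminf_not_top) auto
    then have "summable (\<lambda>k. X (Suc k) u - X k u)" by (rule summable_norm_cancel)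
    then have "convergent (\<lambda>n. \<Sum>k<n. X (Suc k) u - X k u)" by (simp add: summable_iff_convergent)
    then have "convergent (\<lambda>n. X n u - X 0 u)"
      by (simp only: sum_lessThan_telescope[where f = "\<lambda>k. X k u"])
    then have "convergent (\<lambda>n. (X n u - X 0 u) + X 0 u)" by (intro convergent_add convergent_const)
    then show ?case by simp
  qed
qed

lemma tendsto_fun_iff:
  fixes l :: "'i \<Rightarrow> 'a::topological_space"
  shows "(X \<longlongrightarrow> l) F \<longleftrightarrow> (\<forall>i. ((\<lambda>k. X k i) \<longlongrightarrow> l i) F)"
  using limitin_componentwise[of "\<lambda>_::'i. euclidean :: 'a topology" UNIV X l F]
  by (simp add: euclidean_product_topology)

text \<open>A single random sequence \<open>Y\<close> serves all test functions. These live on the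
  whole space, because it is this very convergence that later shows \<open>Y\<close> to lie in the
  orbit closure almost surely.\<close>

lemma RAP_random_limit:
  fixes f :: "nat \<Rightarrow> complex"
  assumes RAP: "RAP f" and f: "\<And>n. n > 0 \<Longrightarrow> norm (f n) \<le> 1"
  shows "\<exists>Y \<in> borel_measurable unit_interval_measure.
    \<forall>(\<phi> :: (int \<Rightarrow> complex) \<Rightarrow> complex) C. continuous_on UNIV \<phi> \<longrightarrow> (\<forall>x. norm (\<phi> x) \<le> C) \<longrightarrow>
      (\<lambda>N. (1 / real N) *\<^sub>R (\<Sum>n=1..N. \<phi> (left_shift (int n) (extend_by_zero f))))
        \<longlonglongrightarrow> integral\<^sup>L unit_interval_measure (\<lambda>u. \<phi> (Y u))"
proof -
  interpret U: prob_space unit_interval_measure by (rule prob_space_unit_interval_measure)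
  define e :: "nat \<Rightarrow> real" where "e k = (1/2) ^ k" for k
  have e: "e k > 0" for k by (simp add: e_def)
  have "\<forall>k. \<exists>G K. (\<forall>m. norm (G m) \<le> 1) \<and> (\<forall>m. G (m + fact K) = G m) \<and>
    (\<forall>\<^sub>F N in sequentially. (\<Sum>n\<in>{1..<N}. norm (f n - G (int n))) \<le> e k * real N)"
    using RAP_approximant[OF RAP f e] by metis
  then obtain G :: "nat \<Rightarrow> int \<Rightarrow> complex" and K :: "nat \<Rightarrow> nat"
    where G1: "\<And>k m. norm (G k m) \<le> 1" and Gper: "\<And>k m. G k (m + fact (K k)) = G k m"
      and Gclose: "\<And>k. \<forall>\<^sub>F N in sequentially.
        (\<Sum>n\<in>{1..<N}. norm (f n - G k (int n))) \<le> e k * real N"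
    by metis
  define x where "x = extend_by_zero f"
  have x1: "norm (x m) \<le> 1" for m using f by (simp add: x_def extend_by_zero_def)
  have close: "\<forall>\<^sub>F N in sequentially.
      (\<Sum>n=1..N. norm (x (int n + m) - G k (int n + m))) \<le> 2 * e k * real N" for k m
    unfolding x_def by (rule shifted_average_le[OF f G1 e Gclose])
  \<comment> \<open>All \<open>V k\<close> take their shift from the same \<open>u\<close>; this
    coupling makes consecutive ones comparable pointwise.\<close>
  define V where "V k u = left_shift (int (unit_interval_residue (K k) u)) (G k)" for k u
  have Gcong: "G k (int a + m) = G k (int b + m)"
    if "a mod fact (K k) = b mod fact (K k)" for k a b m
  proof (rule int_periodic_mod_cong[of "G k" "fact (K k)", OF Gper])
    have "int a mod fact (K k) = int b mod fact (K k)"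
      using that by (metis of_nat_fact zmod_int)
    then show "(int a + m) mod fact (K k) = (int b + m) mod fact (K k)" by (rule mod_add_cong) simp
  qed
  have V1: "norm (V k u m) \<le> 1" for k u m by (simp add: V_def left_shift_def G1)
  have V_meas: "(\<lambda>u. h (V k u)) \<in> borel_measurable unit_interval_measure"
    for h :: "(int \<Rightarrow> complex) \<Rightarrow> 'c::topological_space" and k
    unfolding V_def
    by (rule measurable_compose[OF measurable_unit_interval_residue[of "K k"],
          where g = "\<lambda>r. h (left_shift (int r) (G k))"]) simp
  have V_int: "integrable unit_interval_measure (\<lambda>u. V k u m)" for k m
    by (rule U.integrable_const_bound[of _ 1])
      (use V1 V_meas[of "\<lambda>y. y m"] in auto)

  \<comment> \<open>The expectation is the mean of a periodic sequence, hence a limit of averages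
    along the integers, where both approximants are compared with \<open>x\<close>. The constant is
    \<open>2 * e k + 2 * e (Suc k) = 3 * e k\<close>.\<close>
  have increment: "integral\<^sup>L unit_interval_measure (\<lambda>u. norm (V (Suc k) u m - V k u m))
      \<le> 3 * e k" for k m
  proof -
    \<comment> \<open>Both periods divide \<open>fact L\<close>, so the residue at level
      \<open>L\<close> determines both shifts.\<close>
    define L where "L = max (K k) (K (Suc k))"
    define h where "h r = norm (G (Suc k) (int r + m) - G k (int r + m))" for r
    have "V j u m = G j (int (unit_interval_residue L u) + m)"
      if "j \<in> {k, Suc k}" "u \<in> {0..<1}" for j u
    proof -
      have "unit_interval_residue (K j) u mod fact (K j)
          = unit_interval_residue L u mod fact (K j)"
        using that by (intro unit_interval_residue_mod[symmetric]) (auto simp: L_def)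
      from Gcong[OF this, of m] show ?thesis by (simp add: V_def left_shift_def add.commute)
    qed
    then have "integral\<^sup>L unit_interval_measure (\<lambda>u. norm (V (Suc k) u m - V k u m))
        = integral\<^sup>L unit_interval_measure (\<lambda>u. h (unit_interval_residue L u))"
      by (intro Bochner_Integration.integral_cong) (simp_all add: h_def)
    also have "\<dots> = (1 / fact L) *\<^sub>R (\<Sum>r<fact L. h r)"
      by (rule integral_unit_interval_residue)
    also have "\<dots> \<le> 3 * e k"
    proof (rule tendsto_upperbound)
      have "h (n + fact L) = h n" for n
      proof -
        have "(n + fact L) mod fact (K j) = n mod fact (K j)" if "j \<in> {k, Suc k}" for j
        proof -
          have "fact (K j) dvd (fact L :: nat)" using that by (intro fact_dvd) (auto simp: L_def)
          then show ?thesis by (elim dvdE) simp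
        qed
        then show ?thesis unfolding h_def
          using Gcong[of "n + fact L" k n m] Gcong[of "n + fact L" "Suc k" n m] by simp
      qed
      then show "(\<lambda>N. (1 / real N) *\<^sub>R (\<Sum>n=1..N. h n))
          \<longlonglongrightarrow> (1 / fact L) *\<^sub>R (\<Sum>r<fact L. h r)"
        using periodic_average_tendsto[of "fact L" h] by simp
      show "\<forall>\<^sub>F N in sequentially. (1 / real N) *\<^sub>R (\<Sum>n=1..N. h n) \<le> 3 * e k"
        using close[of m k] close[of m "Suc k"] eventually_gt_at_top[of 0]
      proof eventually_elim
        case (elim N)
        have "(\<Sum>n=1..N. h n) \<le> (\<Sum>n=1..N. norm (x (int n + m) - G k (int n + m))
            + norm (x (int n + m) - G (Suc k) (int n + m)))"
        proof (rule sum_mono)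
          fix n
          show "h n \<le> norm (x (int n + m) - G k (int n + m))
              + norm (x (int n + m) - G (Suc k) (int n + m))"
            using norm_triangle_ineq4[of "x (int n + m) - G k (int n + m)"
                "x (int n + m) - G (Suc k) (int n + m)"] by (simp add: h_def)
        qed
        also have "\<dots> \<le> 2 * e k * real N + 2 * e (Suc k) * real N"
          unfolding sum.distrib by (intro add_mono elim)
        also have "\<dots> = 3 * e k * real N" by (simp add: e_def)
        finally show ?case using elim by (simp add: field_simps)
      qed
    qed simp
    finally show ?thesis .
  qed

  \<comment> \<open>Where the limit does not exist, \<open>lim\<close> has an unspecified value;
    this concerns a null set only, as there are countably many coordinates.\<close>
  define Y where "Y u m = lim (\<lambda>k. V k u m)" for u m
  have Y_meas: "Y \<in> borel_measurable unit_interval_measure"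
  proof (rule measurable_coordinatewise_then_product)
    show "(\<lambda>u. Y u m) \<in> borel_measurable unit_interval_measure" for m
      unfolding Y_def using V_meas[of "\<lambda>y. y m"] by (intro borel_measurable_lim_metric)
  qed
  have "AE u in unit_interval_measure. \<forall>m. convergent (\<lambda>k. V k u m)"
    unfolding AE_all_countable
  proof
    fix m
    show "AE u in unit_interval_measure. convergent (\<lambda>k. V k u m)"
    proof (rule AE_convergent_of_summable_increments[of _ "\<lambda>k u. V k u m" "\<lambda>k. 3 * e k"])
      show "summable (\<lambda>k. 3 * e k)" unfolding e_def by (intro summable_mult summable_geometric) simp
    qed (rule V_int increment)+
  qed
  then have VY: "AE u in unit_interval_measure. (\<lambda>k. V k u) \<longlonglongrightarrow> Y u"
    by eventually_elim (simp add: tendsto_fun_iff Y_def convergent_LIMSEQ_iff)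

  have "(\<lambda>N. (1 / real N) *\<^sub>R (\<Sum>n=1..N. \<phi> (left_shift (int n) x)))
      \<longlonglongrightarrow> integral\<^sup>L unit_interval_measure (\<lambda>u. \<phi> (Y u))"
    if cont: "continuous_on UNIV \<phi>" and bound: "\<And>x. norm (\<phi> x) \<le> C"
    for \<phi> :: "(int \<Rightarrow> complex) \<Rightarrow> complex" and C
  proof (rule tendstoI)
    fix \<epsilon> :: real assume "\<epsilon> > 0"
    \<comment> \<open>The error splits into \<open>\<epsilon> / 2\<close> between the averages
      \<open>A x\<close> and \<open>A (G k)\<close>, \<open>\<epsilon> / 4\<close> between
      \<open>A (G k)\<close> and \<open>EV k\<close>, and \<open>\<epsilon> / 4\<close> between
      \<open>EV k\<close> and \<open>E\<close>. First \<open>k\<close> is fixed, then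
      \<open>N\<close> tends to infinity.\<close>
    define A where "A y = (\<lambda>N. (1 / real N) *\<^sub>R (\<Sum>n=1..N. \<phi> (left_shift (int n) y)))" for y
    define E where "E = integral\<^sup>L unit_interval_measure (\<lambda>u. \<phi> (Y u))"
    define EV where "EV k = integral\<^sup>L unit_interval_measure (\<lambda>u. \<phi> (V k u))" for k
    have "EV \<longlonglongrightarrow> E"
      unfolding EV_def E_def
    proof (rule integral_dominated_convergence[where w = "\<lambda>_. C"])
      show "(\<lambda>u. \<phi> (Y u)) \<in> borel_measurable unit_interval_measure"
        by (rule measurable_compose[OF Y_meas borel_measurable_continuous_onI[OF cont]])
      show "AE u in unit_interval_measure. (\<lambda>k. \<phi> (V k u)) \<longlonglongrightarrow> \<phi> (Y u)"
        using VY
      proof eventually_elim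
        case (elim u)
        have "isCont \<phi> (Y u)" using cont by (simp add: continuous_on_eq_continuous_at)
        then show ?case using elim by (rule isCont_tendsto_compose)
      qed
    qed (use V_meas bound in auto)
    then have ev1: "\<forall>\<^sub>F k in sequentially. dist (EV k) E < \<epsilon> / 4"
      using \<open>\<epsilon> > 0\<close> by (intro tendstoD) auto
    obtain L I where LI: "L \<ge> 0" "finite I"
      and window: "\<forall>y z. (\<forall>m. norm (y m) \<le> 1) \<longrightarrow> (\<forall>m. norm (z m) \<le> 1)
        \<longrightarrow> norm (\<phi> y - \<phi> z) \<le> \<epsilon> / 4 + L * (\<Sum>m\<in>I. norm (y m - z m))"
      using continuous_unit_polydisc_window[OF cont bound divide_pos_pos[OF \<open>\<epsilon> > 0\<close>, of 4]]
      by auto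
    have "(\<lambda>k. L * real (card I) * (2 * e k)) \<longlonglongrightarrow> L * real (card I) * (2 * 0)"
      unfolding e_def by (intro tendsto_intros LIMSEQ_power_zero) simp
    then have ev2: "\<forall>\<^sub>F k in sequentially. L * real (card I) * (2 * e k) < \<epsilon> / 4"
      using \<open>\<epsilon> > 0\<close> by (intro order_tendstoD) auto
    obtain k where k: "dist (EV k) E < \<epsilon> / 4" "L * real (card I) * (2 * e k) < \<epsilon> / 4"
      using eventually_happens[OF eventually_conj[OF ev1 ev2]] by auto
    \<comment> \<open>A uniform random shift averages \<open>\<phi>\<close> over one period of the
      orbit of \<open>G k\<close>, which is also the limit of the averages along that orbit.\<close>
    have "A (G k) \<longlonglongrightarrow> EV k"
    proof -
      have "\<phi> (left_shift (int (n + fact (K k))) (G k)) = \<phi> (left_shift (int n) (G k))" for n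
      proof -
        have "left_shift (int (n + fact (K k))) (G k) = left_shift (int n) (G k)"
          using Gcong[of "n + fact (K k)" k n] by (simp add: left_shift_def add.commute fun_eq_iff)
        then show ?thesis by simp
      qed
      then show ?thesis
        using periodic_average_tendsto[of "fact (K k)" "\<lambda>n. \<phi> (left_shift (int n) (G k))"]
          integral_unit_interval_residue[of "\<lambda>n. \<phi> (left_shift (int n) (G k))" "K k"]
        by (simp add: A_def EV_def V_def)
    qed
    then have "\<forall>\<^sub>F N in sequentially. dist (A (G k) N) (EV k) < \<epsilon> / 4"
      using \<open>\<epsilon> > 0\<close> by (intro tendstoD) auto
    moreover have "\<forall>\<^sub>F N in sequentially. \<forall>m\<in>I.
        (\<Sum>n=1..N. norm (x (int n + m) - G k (int n + m))) \<le> 2 * e k * real N"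
      using LI(2) close by (intro eventually_ball_finite) auto
    ultimately have "\<forall>\<^sub>F N in sequentially. dist (A x N) E < \<epsilon>"
      using eventually_gt_at_top[of 0]
    proof eventually_elim
      case (elim N)
      have "norm (\<Sum>n=1..N. \<phi> (left_shift (int n) x) - \<phi> (left_shift (int n) (G k)))
          \<le> (\<Sum>n=1..N. \<epsilon> / 4 + L * (\<Sum>m\<in>I. norm (x (int n + m) - G k (int n + m))))"
      proof (rule sum_norm_le)
        fix n
        show "norm (\<phi> (left_shift (int n) x) - \<phi> (left_shift (int n) (G k)))
            \<le> \<epsilon> / 4 + L * (\<Sum>m\<in>I. norm (x (int n + m) - G k (int n + m)))"
          using window[rule_format, of "left_shift (int n) x" "left_shift (int n) (G k)"] x1 G1
          by (simp add: left_shift_def add.commute)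
      qed
      also have "\<dots> = real N * (\<epsilon> / 4)
          + L * (\<Sum>n=1..N. \<Sum>m\<in>I. norm (x (int n + m) - G k (int n + m)))"
        by (simp add: sum.distrib sum_distrib_left)
      \<comment> \<open>Exchanging the sums leaves, for each \<open>m\<close> in the window, the
        shifted error sum controlled by \<open>close\<close>.\<close>
      also have "\<dots> \<le> real N * (\<epsilon> / 4) + L * (\<Sum>m\<in>I. 2 * e k * real N)"
        using elim(2) LI(1)
        by (subst sum.swap) (intro add_left_mono mult_left_mono sum_mono, auto)
      also have "\<dots> = real N * (\<epsilon> / 4 + L * real (card I) * (2 * e k))"
        by (simp add: algebra_simps)
      also have "\<dots> \<le> real N * (\<epsilon> / 2)"
        using k(2) by (intro mult_left_mono) auto
      finally have "dist (A x N) (A (G k) N) \<le> \<epsilon> / 2"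
        using elim(3)
        by (simp add: dist_norm A_def scaleR_diff_right[symmetric] sum_subtractf[symmetric]
            field_simps)
      then show ?case
        using elim(1) k(1) \<open>\<epsilon> > 0\<close>
          dist_triangle[of "A x N" E "A (G k) N"] dist_triangle[of "A (G k) N" E "EV k"]
        by linarith
    qed
    then show "\<forall>\<^sub>F N in sequentially. dist ((1 / real N) *\<^sub>R
        (\<Sum>n=1..N. \<phi> (left_shift (int n) x))) (integral\<^sup>L unit_interval_measure (\<lambda>u. \<phi> (Y u))) < \<epsilon>"
      by (simp add: A_def E_def)
  qed
  then show ?thesis using Y_meas unfolding x_def by blast
qed

section \<open>The Furstenberg system as the law of the random limit\<close>

text \<open>Two gaps separate this from the random limit: \<open>Y\<close> has to take values in the
  orbit closure, and test functions given only there have to be extended to the whole space by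
  Tietze's theorem.\<close>

theorem RAP_imp_unique_furstenberg_system:
  fixes f :: "nat \<Rightarrow> complex"
  assumes "RAP f" and f: "\<And>n. n > 0 \<Longrightarrow> norm (f n) \<le> 1"
  shows "has_unique_furstenberg_system f"
proof -
  interpret U: prob_space unit_interval_measure by (rule prob_space_unit_interval_measure)
  define x where "x = extend_by_zero f"
  define X where "X = orbit_closure f"
  have x_in: "left_shift n x \<in> X" for n
    unfolding x_def X_def by (rule shift_in_orbit_closure)
  have closed: "closed X" unfolding X_def by (rule closed_orbit_closure)
  have "X \<subseteq> {y. \<forall>m. norm (y m) \<le> 1}"
    unfolding X_def orbit_closure_def
  proof (rule closure_minimal)
    show "range (\<lambda>n. left_shift n (extend_by_zero f)) \<subseteq> {y. \<forall>m. norm (y m) \<le> 1}"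
      using f by (auto simp: left_shift_def extend_by_zero_def)
    show "closed {y :: int \<Rightarrow> complex. \<forall>m. norm (y m) \<le> 1}"
      by (rule compact_imp_closed) (rule compact_unit_polydisc)
  qed
  then have "compact X"
    using compact_Int_closed[OF compact_unit_polydisc closed]
    by (simp add: Int_absorb1)
  obtain Y :: "real \<Rightarrow> int \<Rightarrow> complex"
    where Y_meas: "Y \<in> borel_measurable unit_interval_measure"
      and lim': "\<forall>(\<phi> :: (int \<Rightarrow> complex) \<Rightarrow> complex) C.
        continuous_on UNIV \<phi> \<longrightarrow> (\<forall>y. norm (\<phi> y) \<le> C) \<longrightarrow>
        (\<lambda>N. (1 / real N) *\<^sub>R (\<Sum>n=1..N. \<phi> (left_shift (int n) x)))
          \<longlonglongrightarrow> integral\<^sup>L unit_interval_measure (\<lambda>u. \<phi> (Y u))"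
    using RAP_random_limit[OF assms] unfolding x_def by blast
  note lim = lim'[rule_format]
  have Y_in: "AE u in unit_interval_measure. Y u \<in> X"
  proof -
    \<comment> \<open>The distance to \<open>X\<close>, truncated to be a bounded test function,
      vanishes along the orbit. So its expectation at \<open>Y\<close> is zero, and \<open>Y\<close>
      lies in the closed set \<open>X\<close> almost surely.\<close>
    define \<psi> where "\<psi> y = min 1 (infdist y X)" for y
    have cont: "continuous_on UNIV \<psi>" unfolding \<psi>_def by (intro continuous_intros)
    have \<psi>: "0 \<le> \<psi> y" "\<psi> y \<le> 1" for y by (auto simp: \<psi>_def infdist_nonneg)
    have \<psi>_in: "\<psi> y = 0" if "y \<in> X" for y using that by (simp add: \<psi>_def)
    have "(\<lambda>N. (1 / real N) *\<^sub>R (\<Sum>n=1..N. complex_of_real (\<psi> (left_shift (int n) x))))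
        \<longlonglongrightarrow> integral\<^sup>L unit_interval_measure (\<lambda>u. complex_of_real (\<psi> (Y u)))"
      using cont \<psi> by (intro lim[of _ 1] continuous_intros) auto
    then have "integral\<^sup>L unit_interval_measure (\<lambda>u. complex_of_real (\<psi> (Y u))) = 0"
      by (simp add: \<psi>_in[OF x_in] LIMSEQ_const_iff)
    then have "integral\<^sup>L unit_interval_measure (\<lambda>u. \<psi> (Y u)) = 0" by simp
    moreover have "integrable unit_interval_measure (\<lambda>u. \<psi> (Y u))"
      using \<psi> measurable_compose[OF Y_meas borel_measurable_continuous_onI[OF cont]]
      by (intro U.integrable_const_bound[of _ 1]) auto
    ultimately have "AE u in unit_interval_measure. \<psi> (Y u) = 0"
      using \<psi> by (subst (asm) integral_nonneg_eq_0_iff_AE) auto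
    then show ?thesis
    proof eventually_elim
      case (elim u)
      then have "infdist (Y u) X = 0" by (auto simp: \<psi>_def min_def split: if_splits)
      then show ?case using in_closed_iff_infdist_zero[OF closed] x_in by blast
    qed
  qed
  \<comment> \<open>On the exceptional null set any point of \<open>X\<close> will do;
    \<open>Z\<close> maps everywhere into \<open>X\<close> and so has a law on
    \<open>X\<close>.\<close>
  define Z where "Z u = (if Y u \<in> X then Y u else x)" for u
  have x_X: "x \<in> X" using x_in[of 0] by (simp add: left_shift_def)
  have Z_meas: "Z \<in> unit_interval_measure \<rightarrow>\<^sub>M restrict_space borel X"
  proof (rule measurable_restrict_space2)
    show "Z \<in> space unit_interval_measure \<rightarrow> X" using x_X by (auto simp: Z_def)
    show "Z \<in> borel_measurable unit_interval_measure"
      unfolding Z_def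
    proof (rule measurable_If[OF Y_meas measurable_const])
      have "Y -` X \<inter> space unit_interval_measure \<in> sets unit_interval_measure"
        using Y_meas closed by (intro measurable_sets[of Y _ borel]) auto
      moreover have "Y -` X \<inter> space unit_interval_measure
          = {u \<in> space unit_interval_measure. Y u \<in> X}" by blast
      ultimately show "{u \<in> space unit_interval_measure. Y u \<in> X} \<in> sets unit_interval_measure"
        by metis
    qed simp
  qed
  define \<nu> where "\<nu> = distr unit_interval_measure (restrict_space borel X) Z"
  have "borel_prob_on X \<nu>"
    unfolding borel_prob_on_def \<nu>_def using Z_meas by (simp add: U.prob_space_distr)
  moreover have "weak_star_limit X (empirical_measure f) \<nu>"
    unfolding weak_star_limit_def
  proof (intro allI impI)
    fix \<phi> :: "(int \<Rightarrow> complex) \<Rightarrow> complex" assume cont: "continuous_on X \<phi>"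
    then have "bounded (\<phi> ` X)"
      using \<open>compact X\<close> by (intro compact_imp_bounded compact_continuous_image)
    then obtain C where C: "\<And>y. y \<in> X \<Longrightarrow> norm (\<phi> y) \<le> C" by (auto simp: bounded_iff)
    have "C \<ge> 0" using C[OF x_X] by (rule order_trans[OF norm_ge_zero])
    \<comment> \<open>The extension keeps the bound \<open>C\<close>, as the random limit requires.
      Neither side of the limit changes: the orbit lies in \<open>X\<close>, and so does
      \<open>Y\<close> almost surely.\<close>
    obtain \<phi>' where \<phi>': "continuous_on UNIV \<phi>'" "\<And>y. y \<in> X \<Longrightarrow> \<phi>' y = \<phi> y"
      "\<And>y. norm (\<phi>' y) \<le> C"
      using Tietze[OF cont, of UNIV C] closed \<open>C \<ge> 0\<close> C by auto
    have "integral\<^sup>L \<nu> \<phi> = integral\<^sup>L unit_interval_measure (\<lambda>u. \<phi> (Z u))"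
      unfolding \<nu>_def using Z_meas borel_measurable_continuous_on_restrict[OF cont]
      by (rule integral_distr)
    also have "\<dots> = integral\<^sup>L unit_interval_measure (\<lambda>u. \<phi>' (Y u))"
    proof (rule integral_cong_AE)
      show "AE u in unit_interval_measure. \<phi> (Z u) = \<phi>' (Y u)"
        using Y_in by eventually_elim (simp add: Z_def \<phi>'(2))
      show "(\<lambda>u. \<phi> (Z u)) \<in> borel_measurable unit_interval_measure"
        by (rule measurable_compose[OF Z_meas borel_measurable_continuous_on_restrict[OF cont]])
      show "(\<lambda>u. \<phi>' (Y u)) \<in> borel_measurable unit_interval_measure"
        by (rule measurable_compose[OF Y_meas borel_measurable_continuous_onI[OF \<phi>'(1)]])
    qed
    finally have "integral\<^sup>L \<nu> \<phi> = integral\<^sup>L unit_interval_measure (\<lambda>u. \<phi>' (Y u))" .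
    moreover have "integral\<^sup>L (empirical_measure f N) \<phi>
        = (1 / real N) *\<^sub>R (\<Sum>n=1..N. \<phi>' (left_shift (int n) x))" for N
      using integral_empirical_measure[of f \<phi> N] cont \<phi>'(2)[OF x_in]
      by (simp add: X_def x_def scaleR_conv_of_real)
    ultimately show "(\<lambda>N. integral\<^sup>L (empirical_measure f N) \<phi>) \<longlonglongrightarrow> integral\<^sup>L \<nu> \<phi>"
      using lim[OF \<phi>'(1,3)] by simp
  qed
  ultimately show ?thesis
    unfolding has_unique_furstenberg_system_def X_def by blast
qed

section \<open>Existence of the mean\<close>

text \<open>The coordinate at \<open>0\<close> is a continuous test function, and its value at the
  \<open>n\<close>-th shift is \<open>f n\<close> for \<open>n \<ge> 1\<close>.\<close>

lemma unique_furstenberg_system_imp_mean_convergent: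
  assumes "has_unique_furstenberg_system f"
  shows "convergent (\<lambda>N. (1 / of_nat N) * (\<Sum>n=1..N. f n))"
proof -
  obtain \<nu> where \<nu>: "weak_star_limit (orbit_closure f) (empirical_measure f) \<nu>"
    using assms by (auto simp: has_unique_furstenberg_system_def)
  have cont: "continuous_on (orbit_closure f) (\<lambda>y. y (0::int))"
    by (rule continuous_on_subset[OF continuous_on_product_coordinates]) simp
  have "integral\<^sup>L (empirical_measure f N) (\<lambda>y. y 0) = (1 / of_nat N) * (\<Sum>n=1..N. f n)" for N
    unfolding integral_empirical_measure[OF cont] by (simp add: left_shift_def extend_by_zero_def)
  moreover have "convergent (\<lambda>N. integral\<^sup>L (empirical_measure f N) (\<lambda>y. y 0))"
    using \<nu> cont unfolding weak_star_limit_def by (blast intro: convergentI)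
  ultimately show ?thesis by simp
qed

theorem corollary2p8:
  fixes f chi :: "nat \<Rightarrow> complex" and q :: nat and F :: "nat set"
  assumes "f \<in> class_M"
    and "dirichlet_character q chi"
    and "infinite F"
    and "\<forall>p\<in>F. prime p"
    and "(\<lambda>p. 1 / real p) summable_on F"
    and "\<forall>n>0. (\<forall>p\<in>F. coprime n p) \<longrightarrow> f n = chi n"
  shows "RAP f \<and> has_unique_furstenberg_system f \<and>
         convergent (\<lambda>N. (1 / of_nat N) * (\<Sum>n=1..N. f n))"
proof -
  have "RAP f" using assms(1,2,4-6) by (rule RAP_of_eq_character)
  moreover from this have "has_unique_furstenberg_system f"
    using assms(1) by (intro RAP_imp_unique_furstenberg_system) (auto simp: class_M_def)
  ultimately show ?thesis
    using unique_furstenberg_system_imp_mean_convergent by blast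
qed

end
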